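(* If a Pythagorean equable parallelogram has sides $a,b$ with $a\le b$, then $a\in\{3,4,5,6,10\}$. There are five infinite families of such parallelograms, which are given by the solutions of corresponding Pell or Pell-like equations; that is, for each of the following five values of $a$, the set of $b\ge a$ for which there is a Pythagorean equable parallelogram with sides $a,b$ is infinite and consists exactly of the values $b\ge a$ given by the stated formula as $(x,y)$ ranges over the integer solutions of the stated equation: (F1) $a=3$, $b=\frac{3(x^2+y^2)}{2}$, where $y^2-5x^2=4$; (F2) $a=4$, $b=4(x^2+y^2)$, where $y^2-3x^2=1$; (F3) $a=5$, $b=\frac{x^2+y^2}{2}$, where $3y^2-7x^2=20$; (F4) $a=6$, $b=3(x^2+y^2)$, where $y^2-2x^2=1$; (F5) $a=10$, $b=x^2+y^2$, where $2y^2-3x^2=5$.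
   Context: A lattice equable parallelogram (LEP) is a (non-degenerate) parallelogram in the plane whose perimeter equals its area and whose vertices lie on the integer lattice $\mathbb{Z}^2$; "sides $a,b$" refers to its side lengths. A rectangle $R$ is said here to circumscribe a parallelogram $P$, sharing a common diagonal with it, if $P\subseteq R$, $P$ and $R$ have a diagonal in common, and two opposite sides of $R$ lie on the lines containing two opposite sides of $P$ (there are in general two such rectangles: one whose sides extend the long sides of $P$ and one whose sides extend the short sides; if $P$ is a rectangle then $R=P$). $R$ need not have sides parallel to the coordinate axes. A LEP is Pythagorean (equivalently, is called a Pythagorean equable parallelogram) if it is circumscribed in this way by a rectangle having integer side lengths. *)

theory Defs
  imports "HOL-Analysis.Analysis"
begin

text \<open>
  A quadrilateral is given by its four vertices, listed in cyclic order; the region it bounds is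
  the convex hull of the vertices.
\<close>

definition parallelogram :: "real^2 \<Rightarrow> real^2 \<Rightarrow> real^2 \<Rightarrow> real^2 \<Rightarrow> bool" where
  "parallelogram A B C D \<longleftrightarrow> B - A = C - D \<and> \<not> collinear {A, B, C}"

definition rectangle :: "real^2 \<Rightarrow> real^2 \<Rightarrow> real^2 \<Rightarrow> real^2 \<Rightarrow> bool" where
  "rectangle A B C D \<longleftrightarrow> parallelogram A B C D \<and> orthogonal (B - A) (D - A)"

definition perimeter :: "real^2 \<Rightarrow> real^2 \<Rightarrow> real^2 \<Rightarrow> real^2 \<Rightarrow> real" where
  "perimeter A B C D = dist A B + dist B C + dist C D + dist D A"

definition area :: "real^2 \<Rightarrow> real^2 \<Rightarrow> real^2 \<Rightarrow> real^2 \<Rightarrow> real" where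
  "area A B C D = measure lebesgue (convex hull {A, B, C, D})"

definition lattice_point :: "real^2 \<Rightarrow> bool" where
  "lattice_point P \<longleftrightarrow> (\<forall>i. P $ i \<in> \<int>)"

definition LEP :: "real^2 \<Rightarrow> real^2 \<Rightarrow> real^2 \<Rightarrow> real^2 \<Rightarrow> bool" where
  "LEP A B C D \<longleftrightarrow>
     parallelogram A B C D \<and>
     lattice_point A \<and> lattice_point B \<and> lattice_point C \<and> lattice_point D \<and>
     perimeter A B C D = area A B C D"

definition opposite_sides ::
    "real^2 \<Rightarrow> real^2 \<Rightarrow> real^2 \<Rightarrow> real^2 \<Rightarrow> ((real^2) set \<times> (real^2) set) set" where
  "opposite_sides A B C D =
     {(closed_segment A B, closed_segment C D), (closed_segment C D, closed_segment A B),
      (closed_segment B C, closed_segment D A), (closed_segment D A, closed_segment B C)}"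

definition diagonals :: "real^2 \<Rightarrow> real^2 \<Rightarrow> real^2 \<Rightarrow> real^2 \<Rightarrow> (real^2) set set" where
  "diagonals A B C D = {closed_segment A C, closed_segment B D}"

text \<open>
  The rectangle \<open>E F G H\<close> circumscribes the parallelogram \<open>A B C D\<close>, sharing a common diagonal.
  The sides of the parallelogram that are extended may be the long or the short ones.
\<close>

definition circumscribes ::
    "real^2 \<Rightarrow> real^2 \<Rightarrow> real^2 \<Rightarrow> real^2 \<Rightarrow> real^2 \<Rightarrow> real^2 \<Rightarrow> real^2 \<Rightarrow> real^2 \<Rightarrow> bool" where
  "circumscribes E F G H A B C D \<longleftrightarrow>
     rectangle E F G H \<and> parallelogram A B C D \<and>
     convex hull {A, B, C, D} \<subseteq> convex hull {E, F, G, H} \<and>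
     diagonals E F G H \<inter> diagonals A B C D \<noteq> {} \<and>
     (\<exists>(R1, R2) \<in> opposite_sides E F G H. \<exists>(P1, P2) \<in> opposite_sides A B C D.
        R1 \<subseteq> affine hull P1 \<and> R2 \<subseteq> affine hull P2)"

definition pythagorean_LEP :: "real^2 \<Rightarrow> real^2 \<Rightarrow> real^2 \<Rightarrow> real^2 \<Rightarrow> bool" where
  "pythagorean_LEP A B C D \<longleftrightarrow>
     LEP A B C D \<and>
     (\<exists>E F G H. circumscribes E F G H A B C D \<and> dist E F \<in> \<int> \<and> dist F G \<in> \<int>)"

definition pythagorean_LEP_with_sides :: "real \<Rightarrow> real \<Rightarrow> bool" where
  "pythagorean_LEP_with_sides a b \<longleftrightarrow>
     (\<exists>A B C D. pythagorean_LEP A B C D \<and> {dist A B, dist B C} = {a, b})"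

definition long_sides :: "real \<Rightarrow> real set" where
  "long_sides a = {b. a \<le> b \<and> pythagorean_LEP_with_sides a b}"

end

theory Submission
  imports Defs
begin

text \<open>
  Let \<open>l\<close>, \<open>m\<close> be the side lengths, where the rectangle extends the sides of length \<open>l\<close>, and let
  \<open>h\<close> be the distance between these sides, so that \<open>h l = 2 (l + m)\<close>. Integrality of the rectangle
  and of the vertices forces \<open>l\<close> and \<open>s = \<surd>(m\<^sup>2 - h\<^sup>2)\<close> to be integers. With \<open>k = h - 2 = 2 m / l\<close> and
  \<open>t = 2 s\<close> this becomes \<open>t\<^sup>2 = (l\<^sup>2 - 4) k\<^sup>2 - 16 k - 16\<close>, a Pell-type equation whose
  solutions descend, for fixed \<open>l\<close>, to ones with \<open>(l\<^sup>2 - 4) (k - 2) \<le> 16\<close>. For \<open>l \<ge> 5\<close> this leaves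
  \<open>k \<in> {1, 2}\<close>, i.e. \<open>l\<^sup>2 - 36\<close> or \<open>l\<^sup>2 - 16\<close> is a square. Running the descent backwards
  parametrises all \<open>k\<close> by solutions of the Pell-like equations.
\<close>

section \<open>Descent for the Pell-type equation\<close>

text \<open>
  With \<open>X = (a\<^sup>2 - 4) k - 8\<close> the equation reads \<open>X\<^sup>2 - (a\<^sup>2 - 4) t\<^sup>2 = 16 a\<^sup>2\<close>. The step multiplies
  \<open>X + t \<surd>(a\<^sup>2 - 4)\<close> by the unit \<open>(a\<^sup>2 - 2 + a \<surd>(a\<^sup>2 - 4)) / 2\<close>. This is the square of the smaller
  unit \<open>(a + \<surd>(a\<^sup>2 - 4)) / 2\<close>, which does not preserve the residue of \<open>X\<close> modulo \<open>a\<^sup>2 - 4\<close>.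
\<close>

lemma descent_induct [consumes 3, case_names base neg step]:
  fixes a k t :: int
  assumes a: "0 < a" and k: "0 < k" and eq: "t^2 = (a^2 - 4) * k^2 - 16 * k - 16"
    and base: "\<And>k t. 0 < k \<Longrightarrow> (a^2 - 4) * (k - 2) \<le> 16 \<Longrightarrow> t^2 = (a^2 - 4) * k^2 - 16 * k - 16 \<Longrightarrow> P k t"
    and neg: "\<And>k t. P k t \<Longrightarrow> P k (- t)"
    and step: "\<And>k t K T. P k t \<Longrightarrow> 2 * K = (a^2 - 2) * k - 8 + a * t \<Longrightarrow>
      2 * T = (a^2 - 2) * t + a * ((a^2 - 4) * k - 8) \<Longrightarrow> P K T"
  shows "P k t"
  using k eq
proof (induction "nat k" arbitrary: k t rule: less_induct)
  case less
  \<comment> \<open>For a nonnegative root, multiplying by the conjugate unit lowers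
    \<open>k\<close>; a negative root is handled afterwards through \<open>neg\<close>.\<close>
  have nonneg: "P k u" if u0: "0 \<le> u" and u: "u^2 = (a^2 - 4) * k^2 - 16 * k - 16" for u
  proof (cases "(a^2 - 4) * (k - 2) \<le> 16")
    case True
    then show ?thesis using base less.prems(1) u by blast
  next
    case False
    define X where "X = (a^2 - 4) * k - 8"
    have X: "X^2 = 16 * a^2 + (a^2 - 4) * u^2"
      unfolding X_def u by (simp add: power2_eq_square algebra_simps)
    \<comment> \<open>The base bound is chosen so that its failure is exactly this inequality, which
      \<open>lower\<close> needs.\<close>
    have big: "2 * a^2 < X" using False by (simp add: X_def algebra_simps)
    have Xpos: "0 < X" using big zero_le_power2[of a] by linarith
    have a2: "4 < a^2"
    proof (rule ccontr)
      assume "\<not> 4 < a^2"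
      then have "(a^2 - 4) * k \<le> 0" using less.prems(1) by (simp add: mult_nonpos_nonneg)
      then show False using Xpos by (simp add: X_def)
    qed
    \<comment> \<open>This amounts to \<open>k' < k\<close> for the descended value
      \<open>k'\<close> below; \<open>upper\<close> yields \<open>0 < k'\<close>.\<close>
    have lower: "X < a * u"
    proof -
      have "(2 * a^2)^2 < X^2" using big a by (intro power_strict_mono) auto
      then have "(a^2 - 4) * (4 * a^2) < (a^2 - 4) * u^2"
        unfolding X by (simp add: power2_eq_square algebra_simps)
      then have "4 * a^2 < u^2" using a2 by simp
      then have "X^2 < (a * u)^2" unfolding X by (simp add: power_mult_distrib algebra_simps)
      then show ?thesis using a u0 by (intro power2_less_imp_less[of X]) auto
    qed
    have upper: "a * (a^2 - 4) * u < (a^2 - 2) * X"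
    proof (rule power2_less_imp_less)
      \<comment> \<open>Rests on \<open>(a^2 - 2)^2 = a^2 * (a^2 - 4) + 4\<close>, the norm equation
        of the unit.\<close>
      have id: "((a^2 - 2) * X)^2 - (a * (a^2 - 4) * u)^2 = a^2 * (a^2-4) * (X^2 - (a^2-4) * u^2) + 4 * X^2"
        by (simp add: power2_eq_square algebra_simps)
      have "0 < a^2 * (a^2-4) * (16 * a^2) + 4 * X^2"
        using a2 Xpos by (intro add_pos_pos mult_pos_pos) auto
      then show "(a * (a^2 - 4) * u)^2 < ((a^2 - 2) * X)^2" using id X by simp
      show "0 \<le> (a^2 - 2) * X" using a2 Xpos by simp
    qed
    \<comment> \<open>\<open>u\<close> and \<open>a * k\<close> have equal parity, so the halves
      \<open>k'\<close> and \<open>t'\<close> are integers.\<close>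
    have "even (u^2) = even (a^2 * k^2)" unfolding u by (simp add: left_diff_distrib)
    then have ev: "even ((a^2 - 2) * k - 8 - a * u)" by auto
    then obtain k' where k': "2 * k' = (a^2 - 2) * k - 8 - a * u" by (metis evenE)
    have "even ((a^2 - 2) * u - a * ((a^2 - 4) * k - 8))" using \<open>even (u^2) = _\<close> by auto
    then obtain t' where t': "2 * t' = (a^2 - 2) * u - a * ((a^2 - 4) * k - 8)" by (metis evenE)
    have "k' < k" using lower k' by (simp add: X_def algebra_simps)
    have "(a^2 - 4) * (2 * k') = ((a^2 - 2) * X - a * (a^2 - 4) * u) + 16"
      unfolding k' X_def by (simp add: algebra_simps power2_eq_square)
    then have "0 < (a^2 - 4) * (2 * k')" using upper by linarith
    then have k'pos: "0 < k'" using a2 by (simp add: zero_less_mult_iff)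
    \<comment> \<open>The bracket added at the end vanishes by the equation for
      \<open>u\<close>.\<close>
    have "(2 * t')^2 = (a^2 - 4) * (2*k')^2 - 32 * (2 * k') - 64
            + (4 * u^2 - 4 * ((a^2 - 4) * k^2 - 16 * k - 16))"
      unfolding t' k' by (simp add: power2_eq_square algebra_simps)
    then have "t'^2 = (a^2 - 4) * k'^2 - 16 * k' - 16"
      unfolding u by (simp add: power_mult_distrib algebra_simps)
    then have P': "P k' t'" using less.hyps[of k' t'] \<open>k' < k\<close> k'pos by simp
    show ?thesis
    proof (rule step[OF P'])
      have "2 * (2 * k) = (a^2 - 2) * (2 * k') - 16 + a * (2 * t')"
        unfolding t' k' by (simp add: power2_eq_square algebra_simps)
      then show "2 * k = (a^2 - 2) * k' - 8 + a * t'" by (simp add: algebra_simps)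
      have "2 * (2 * u) = (a^2 - 2) * (2 * t') + a * ((a^2 - 4) * (2 * k') - 16)"
        unfolding t' k' by (simp add: power2_eq_square algebra_simps)
      then show "2 * u = (a^2 - 2) * t' + a * ((a^2 - 4) * k' - 8)" by (simp add: algebra_simps)
    qed
  qed
  show ?case
  proof (cases "0 \<le> t")
    case True
    then show ?thesis using nonneg less.prems(2) by blast
  next
    case False
    then have "P k (- t)" using nonneg less.prems(2) by simp
    then show ?thesis using neg by fastforce
  qed
qed

section \<open>The five possible side lengths\<close>

text \<open>The factors \<open>a - \<bar>t\<bar>\<close> and \<open>a + \<bar>t\<bar>\<close> of 36
  have equal parity, which leaves only 2 * 18 and 6 * 6.\<close>

lemma diff_squares_eq_36:
  fixes a t :: int
  assumes "t^2 = a^2 - 36" "0 < a"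
  shows "a = 6 \<or> a = 10"
proof -
  define d where "d = a - \<bar>t\<bar>"
  have "d * (d + 2 * \<bar>t\<bar>) = a^2 - t^2"
    by (simp add: d_def power2_eq_square algebra_simps)
  then have prod: "d * (d + 2 * \<bar>t\<bar>) = 36" using assms(1) by linarith
  have "\<bar>t\<bar> < a" by (rule power2_less_imp_less) (use assms in auto)
  then have "0 < d" by (simp add: d_def)
  have "d * d \<le> 36" using prod \<open>0 < d\<close> mult_left_mono[of d "d + 2 * \<bar>t\<bar>" d] by simp
  have "d \<le> 6"
  proof (rule ccontr)
    assume "\<not> d \<le> 6"
    then have "7 * 7 \<le> d * d" by (intro mult_mono) auto
    then show False using \<open>d * d \<le> 36\<close> by simp
  qed
  then consider "d = 1" | "d = 2" | "d = 3" | "d = 4" | "d = 5" | "d = 6"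
    using \<open>0 < d\<close> by linarith
  then have "d = 2 \<and> \<bar>t\<bar> = 8 \<or> d = 6 \<and> \<bar>t\<bar> = 0"
    using prod by cases (hypsubst, presburger)+
  then show ?thesis unfolding d_def by linarith
qed

text \<open>As for 36: the factorisations of 16 into factors of equal parity are 2 * 8 and 4 *
  4.\<close>

lemma diff_squares_eq_16:
  fixes a t :: int
  assumes "t^2 = a^2 - 16" "0 < a"
  shows "a = 4 \<or> a = 5"
proof -
  define d where "d = a - \<bar>t\<bar>"
  have "d * (d + 2 * \<bar>t\<bar>) = a^2 - t^2"
    by (simp add: d_def power2_eq_square algebra_simps)
  then have prod: "d * (d + 2 * \<bar>t\<bar>) = 16" using assms(1) by linarith
  have "\<bar>t\<bar> < a" by (rule power2_less_imp_less) (use assms in auto)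
  then have "0 < d" by (simp add: d_def)
  have "d * d \<le> 16" using prod \<open>0 < d\<close> mult_left_mono[of d "d + 2 * \<bar>t\<bar>" d] by simp
  have "d \<le> 4"
  proof (rule ccontr)
    assume "\<not> d \<le> 4"
    then have "5 * 5 \<le> d * d" by (intro mult_mono) auto
    then show False using \<open>d * d \<le> 16\<close> by simp
  qed
  then consider "d = 1" | "d = 2" | "d = 3" | "d = 4"
    using \<open>0 < d\<close> by linarith
  then have "d = 2 \<and> \<bar>t\<bar> = 3 \<or> d = 4 \<and> \<bar>t\<bar> = 0"
    using prod by cases (hypsubst, presburger)+
  then show ?thesis unfolding d_def by linarith
qed

text \<open>The descent keeps \<open>a\<close> fixed, so the conclusion passes through
  \<open>neg\<close> and \<open>step\<close> unchanged and only the base case needs an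
  argument.\<close>

lemma side_cases:
  fixes a k t :: int
  assumes "0 < a" "0 < k" "t^2 = (a^2 - 4) * k^2 - 16 * k - 16"
  shows "a \<in> {3, 4, 5, 6, 10}"
  using assms
proof (induction rule: descent_induct)
  case (base k t)
  have "3 \<le> a"
  proof (rule ccontr)
    \<comment> \<open>For \<open>a \<le> 2\<close> the right-hand side is negative and cannot be a
      square.\<close>
    assume "\<not> 3 \<le> a"
    then have "a^2 \<le> 2^2" using \<open>0 < a\<close> by (intro power_mono) auto
    then have "(a^2 - 4) * k^2 \<le> 0" by (intro mult_nonpos_nonneg) auto
    then show False using base zero_le_power2[of t] by linarith
  qed
  show ?case
  proof (cases "a \<le> 4")
    case True
    with \<open>3 \<le> a\<close> show ?thesis by auto
  next
    case False
    then have "5^2 \<le> a^2" by (intro power_mono) auto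
    have "k \<le> 2"
    proof (rule ccontr)
      assume "\<not> k \<le> 2"
      \<comment> \<open>\<open>5^2 - 4 = 21\<close> already exceeds the base bound 16.\<close>
      then have "21 * 1 \<le> (a^2 - 4) * (k - 2)" using \<open>5^2 \<le> a^2\<close> by (intro mult_mono) auto
      then show False using base by simp
    qed
    then consider "k = 1" | "k = 2" using \<open>0 < k\<close> by linarith
    then show ?thesis
    proof cases
      case 1
      then have "t^2 = a^2 - 36" using base by simp
      then show ?thesis using diff_squares_eq_36 \<open>0 < a\<close> by blast
    next
      case 2
      then have t: "t^2 = 4 * (a^2 - 16)" using base by simp
      then have "even (t^2)" by simp
      then have "even t" by simp
      then obtain u where "t = 2 * u" by (elim evenE)
      then have "u^2 = a^2 - 16" using t by (simp add: power_mult_distrib)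
      then show ?thesis using diff_squares_eq_16 \<open>0 < a\<close> by blast
    qed
  qed
qed

section \<open>Parametrisation of the solutions by Pell-like equations\<close>

lemma not_square_between:
  fixes n t :: int
  assumes "n^2 < t^2" "t^2 < (n + 1)^2" "0 \<le> n"
  shows False
proof -
  have "n < \<bar>t\<bar>" by (rule power2_less_imp_less) (use assms in auto)
  moreover have "\<bar>t\<bar> < n + 1" by (rule power2_less_imp_less) (use assms in auto)
  ultimately show False by linarith
qed

text \<open>
  In each family the solution \<open>(k, t)\<close> is a quadratic expression in \<open>(x, y)\<close>, and multiplying the
  Pell-like solution by the smaller unit \<open>(a + \<surd>(a\<^sup>2 - 4)) / 2\<close> induces the step on \<open>(k, t)\<close>.
\<close>

lemma pell_param_3:
  fixes k t :: int
  assumes "0 < k" "t^2 = (3^2 - 4) * k^2 - 16 * k - 16"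
  shows "\<exists>x y. y^2 - 5 * x^2 = 4 \<and> k = 6 * x^2 + 4 \<and> t = 6 * x * y"
  using zero_less_numeral assms
proof (induction rule: descent_induct)
  case (base k t)
  then have "k \<in> {1,2,3,4,5}" by auto
  \<comment> \<open>The right-hand side is negative for \<open>k \<le> 3\<close>, zero for
    \<open>k = 4\<close>, and 29 for \<open>k = 5\<close>, strictly between \<open>5^2\<close> and
    \<open>6^2\<close>.\<close>
  then have "k = 4 \<and> t = 0"
    using base(3) not_square_between[of 5 t] zero_le_power2[of t]
    by (elim insertE emptyE) auto
  then show ?case by - (rule exI[of _ 0], rule exI[of _ 2], auto)
next
  case (neg k t)
  then obtain x y where "y^2 - 5 * x^2 = 4 \<and> k = 6 * x^2 + 4 \<and> t = 6 * x * y" by blast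
  then show ?case by - (rule exI[of _ "- x"], rule exI[of _ y], auto)
next
  case (step k t K T)
  then obtain x y where xy: "y^2 - 5 * x^2 = 4" "k = 6 * x^2 + 4" "t = 6 * x * y" by blast
  \<comment> \<open>With \<open>X = 5 * k - 8\<close> the parametrisation says
    \<open>X + t * sqrt 5 = 3 * (y + x * sqrt 5)^2\<close>. Equal parity of \<open>x\<close> and
    \<open>y\<close> makes multiplication by \<open>(3 + sqrt 5) / 2\<close> integral. From here on
    \<open>X\<close> and \<open>Y\<close> name the new solution.\<close>
  have "even (y^2 - 5 * x^2)" unfolding xy by simp
  then have "even (3 * x + y)" "even (5 * x + 3 * y)" by auto
  then obtain X Y where X: "2 * X = 3 * x + y" and Y: "2 * Y = 5 * x + 3 * y" by (metis evenE)
  have "4 * X^2 = (3 * x + y)^2" "4 * Y^2 = (5 * x + 3 * y)^2" "4 * (X * Y) = (3 * x + y) * (5 * x + 3 * y)"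
    by (simp_all flip: X Y add: power2_eq_square)
  then have "Y^2 - 5 * X^2 = 4 \<and> K = 6 * X^2 + 4 \<and> T = 6 * X * Y"
    using step(2,3) xy by (simp add: power2_eq_square algebra_simps)
  then show ?case by blast
qed

text \<open>Here \<open>12 * k - 8 + t * sqrt 12 = 16 * (y + x * sqrt 3)^2\<close>, and the step
  multiplies \<open>y + x * sqrt 3\<close> by \<open>2 + sqrt 3\<close>. In the base case
  \<open>k = 3\<close> would give 44, between \<open>6^2\<close> and \<open>7^2\<close>.\<close>

lemma pell_param_4:
  fixes k t :: int
  assumes "0 < k" "t^2 = (4^2 - 4) * k^2 - 16 * k - 16"
  shows "\<exists>x y. y^2 - 3 * x^2 = 1 \<and> k = 8 * x^2 + 2 \<and> t = 16 * x * y"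
  using zero_less_numeral assms
proof (induction rule: descent_induct)
  case (base k t)
  then have "k \<in> {1,2,3}" by auto
  then have "k = 2 \<and> t = 0"
    using base(3) not_square_between[of 6 t] zero_le_power2[of t]
    by (elim insertE emptyE) auto
  then show ?case by - (rule exI[of _ 0], rule exI[of _ 1], auto)
next
  case (neg k t)
  then obtain x y where "y^2 - 3 * x^2 = 1 \<and> k = 8 * x^2 + 2 \<and> t = 16 * x * y" by blast
  then show ?case by - (rule exI[of _ "- x"], rule exI[of _ y], auto)
next
  case (step k t K T)
  then obtain x y where xy: "y^2 - 3 * x^2 = 1" "k = 8 * x^2 + 2" "t = 16 * x * y" by blast
  then show ?case
    using step(2,3)
    by - (rule exI[of _ "2 * x + y"], rule exI[of _ "3 * x + 2 * y"],
        simp add: power2_eq_square algebra_simps)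
qed

text \<open>Here \<open>21 * k - 8 + t * sqrt 21 = (y * sqrt 3 + x * sqrt 7)^2\<close>, and the step
  multiplies the bracket by \<open>(5 + sqrt 21) / 2\<close>, integral because \<open>x\<close> and
  \<open>y\<close> have equal parity.\<close>

lemma pell_param_5:
  fixes k t :: int
  assumes "0 < k" "t^2 = (5^2 - 4) * k^2 - 16 * k - 16"
  shows "\<exists>x y. 3 * y^2 - 7 * x^2 = 20 \<and> 3 * k = 2 * x^2 + 4 \<and> t = 2 * x * y"
  using zero_less_numeral assms
proof (induction rule: descent_induct)
  case (base k t)
  then have "k \<in> {1,2}" by auto
  then have "k = 2 \<and> t^2 = 6^2"
    using base(3) zero_le_power2[of t] by (elim insertE emptyE) auto
  then have "k = 2" "t = 6 \<or> t = -6" using power2_eq_iff by blast+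
  then show ?case by (elim disjE) (rule exI[of _ 1], rule exI[of _ "t div 2"]; simp)+
next
  case (neg k t)
  then obtain x y where "3 * y^2 - 7 * x^2 = 20 \<and> 3 * k = 2 * x^2 + 4 \<and> t = 2 * x * y" by blast
  then show ?case by - (rule exI[of _ "- x"], rule exI[of _ y], auto)
next
  case (step k t K T)
  then obtain x y where xy: "3 * y^2 - 7 * x^2 = 20" "3 * k = 2 * x^2 + 4" "t = 2 * x * y" by blast
  have "even (3 * y^2 - 7 * x^2)" unfolding xy by simp
  then have "even (5 * x + 3 * y)" "even (7 * x + 5 * y)" by auto
  then obtain X Y where X: "2 * X = 5 * x + 3 * y" and Y: "2 * Y = 7 * x + 5 * y" by (metis evenE)
  have "4 * X^2 = (5 * x + 3 * y)^2" "4 * Y^2 = (7 * x + 5 * y)^2"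
    "4 * (X * Y) = (5 * x + 3 * y) * (7 * x + 5 * y)"
    by (simp_all flip: X Y add: power2_eq_square)
  then have "3 * Y^2 - 7 * X^2 = 20 \<and> 3 * K = 2 * X^2 + 4 \<and> T = 2 * X * Y"
    using step(2,3) xy by (simp add: power2_eq_square algebra_simps)
  then show ?case by blast
qed

text \<open>Here \<open>32 * k - 8 + t * sqrt 32 = 24 * (y + x * sqrt 2)^2\<close>, and the step
  multiplies \<open>y + x * sqrt 2\<close> by \<open>3 + 2 * sqrt 2\<close>. In the base case
  \<open>k = 2\<close> would give 80, between \<open>8^2\<close> and \<open>9^2\<close>.\<close>

lemma pell_param_6:
  fixes k t :: int
  assumes "0 < k" "t^2 = (6^2 - 4) * k^2 - 16 * k - 16"
  shows "\<exists>x y. y^2 - 2 * x^2 = 1 \<and> k = 3 * x^2 + 1 \<and> t = 12 * x * y"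
  using zero_less_numeral assms
proof (induction rule: descent_induct)
  case (base k t)
  then have "k \<in> {1,2}" by auto
  then have "k = 1 \<and> t = 0"
    using base(3) not_square_between[of 8 t] by (elim insertE emptyE) auto
  then show ?case by - (rule exI[of _ 0], rule exI[of _ 1], auto)
next
  case (neg k t)
  then obtain x y where "y^2 - 2 * x^2 = 1 \<and> k = 3 * x^2 + 1 \<and> t = 12 * x * y" by blast
  then show ?case by - (rule exI[of _ "- x"], rule exI[of _ y], auto)
next
  case (step k t K T)
  then obtain x y where xy: "y^2 - 2 * x^2 = 1" "k = 3 * x^2 + 1" "t = 12 * x * y" by blast
  then show ?case
    using step(2,3)
    by - (rule exI[of _ "3 * x + 2 * y"], rule exI[of _ "4 * x + 3 * y"],
        simp add: power2_eq_square algebra_simps)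
qed

text \<open>Here \<open>96 * k - 8 + t * sqrt 96 = 8 * (y * sqrt 2 + x * sqrt 3)^2\<close>, and the
  step multiplies the bracket by \<open>5 + 2 * sqrt 6\<close>. In the base case
  \<open>k = 2\<close> would give 336, between \<open>18^2\<close> and \<open>19^2\<close>.\<close>

lemma pell_param_10:
  fixes k t :: int
  assumes "0 < k" "t^2 = (10^2 - 4) * k^2 - 16 * k - 16"
  shows "\<exists>x y. 2 * y^2 - 3 * x^2 = 5 \<and> 2 * k = x^2 + 1 \<and> t = 4 * x * y"
  using zero_less_numeral assms
proof (induction rule: descent_induct)
  case (base k t)
  then have "k \<in> {1,2}" by auto
  then have "k = 1 \<and> t^2 = 8^2"
    using base(3) not_square_between[of 18 t] by (elim insertE emptyE) auto
  then have "k = 1" "t = 8 \<or> t = -8" using power2_eq_iff by blast+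
  then show ?case by (elim disjE) (rule exI[of _ 1], rule exI[of _ "t div 4"]; simp)+
next
  case (neg k t)
  then obtain x y where "2 * y^2 - 3 * x^2 = 5 \<and> 2 * k = x^2 + 1 \<and> t = 4 * x * y" by blast
  then show ?case by - (rule exI[of _ "- x"], rule exI[of _ y], auto)
next
  case (step k t K T)
  then obtain x y where xy: "2 * y^2 - 3 * x^2 = 5" "2 * k = x^2 + 1" "t = 4 * x * y" by blast
  then show ?case
    using step(2,3)
    by - (rule exI[of _ "5 * x + 4 * y"], rule exI[of _ "6 * x + 5 * y"],
        simp add: power2_eq_square algebra_simps)
qed

section \<open>Circumscribing rectangles\<close>

text \<open>The region is the translate by \<open>A\<close> of the image of the unit square under
  the linear map with columns \<open>B - A\<close> and \<open>C - B\<close>, so its measure is the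
  absolute value of the determinant.\<close>

lemma area_parallelogram:
  assumes "parallelogram A B C D"
  shows "area A B C D = \<bar>(B - A) $ 1 * (C - B) $ 2 - (B - A) $ 2 * (C - B) $ 1\<bar>"
proof -
  define v w where "v = B - A" and "w = C - B"
  define f :: "real^2 \<Rightarrow> real^2" where "f z = z $ 1 *\<^sub>R v + z $ 2 *\<^sub>R w" for z
  have lin: "linear f"
    by (rule linearI) (simp_all add: f_def algebra_simps)
  define Q :: "(real^2) set" where "Q = {x. \<forall>i. x $ i = 0 \<or> x $ i = 1}"
  have "Q = {vector [0, 0], vector [1, 0], vector [1, 1], vector [0, 1]}"
    by (auto simp: Q_def vec_eq_iff forall_2)
  then have "f ` Q = {0, v, v + w, w}"
    by (simp add: f_def)
  moreover have "B = A + v" "C = A + (v + w)" "D = A + w"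
    using assms by (auto simp: parallelogram_def v_def w_def algebra_simps)
  ultimately have "{A, B, C, D} = (\<lambda>x. A + x) ` f ` Q"
    by simp
  then have "convex hull {A, B, C, D} = (\<lambda>x. A + x) ` f ` (convex hull Q)"
    by (simp only: convex_hull_translation convex_hull_linear_image[OF lin])
  moreover have "cbox 0 (1 :: real^2) = convex hull Q"
    unfolding Cart_1 unit_interval_convex_hull[where 'a = "real^2"] Q_def
    by (rule arg_cong[where f = "\<lambda>x. convex hull x"]) (simp add: Basis_vec_def inner_axis)
  ultimately have "convex hull {A, B, C, D} = (\<lambda>x. A + x) ` f ` cbox 0 1"
    by simp
  then have "area A B C D = measure lebesgue (f ` cbox 0 1)"
    by (simp add: area_def measure_translation)
  also have "\<dots> = \<bar>det (matrix f)\<bar> * measure lebesgue (cbox 0 (1 :: real^2))"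
    using lin by (intro measure_lebesgue_linear_transformation) auto
  also have "measure lebesgue (cbox 0 (1 :: real^2)) = 1"
    unfolding Cart_1 using content_unit[where 'a = "real^2"] by simp
  also have "det (matrix f) = v $ 1 * w $ 2 - v $ 2 * w $ 1"
    by (simp add: det_2 matrix_def f_def axis_def)
  finally show ?thesis by (simp add: v_def w_def)
qed

lemma inner_vec_2: "(x :: real^2) \<bullet> y = x $ 1 * y $ 1 + x $ 2 * y $ 2"
  by (simp add: inner_vec_def sum_2)

text \<open>Lagrange's identity in the plane: the squared determinant equals the Gram
  determinant.\<close>

lemma area_parallelogram_sq:
  assumes "parallelogram A B C D"
  shows "(area A B C D)^2 = (norm (B - A))^2 * (norm (C - B))^2 - ((B - A) \<bullet> (C - B))^2"
  unfolding area_parallelogram[OF assms] power2_norm_eq_inner inner_vec_2 power2_abs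
  by (simp add: power2_eq_square algebra_simps)

lemma perimeter_parallelogram:
  assumes "parallelogram A B C D"
  shows "perimeter A B C D = 2 * (dist A B + dist B C)"
proof -
  have "C - D = B - A" "D - A = C - B"
    using assms by (auto simp: parallelogram_def algebra_simps)
  then show ?thesis
    by (simp add: perimeter_def dist_norm norm_minus_commute)
qed

text \<open>A normal form that merges the four ordered pairs of opposite sides into one. The edge
  vectors are determined only up to order and sign, which suffices for their norms and the square of
  their inner product.\<close>

lemma opposite_sides_parallelogram:
  assumes "B - A = C - D" "(R1, R2) \<in> opposite_sides A B C D"
  obtains X d e where "R1 = closed_segment X (X + d)" "R2 = closed_segment (X + d + e) (X + e)"
    "(d, e) \<in> {(B - A, C - B), (A - B, B - C), (C - B, A - B), (B - C, B - A)}"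
proof -
  have D: "D = A + C - B" using assms(1) by (simp add: algebra_simps)
  from assms(2) consider
      "R1 = closed_segment A B" "R2 = closed_segment C D"
    | "R1 = closed_segment C D" "R2 = closed_segment A B"
    | "R1 = closed_segment B C" "R2 = closed_segment D A"
    | "R1 = closed_segment D A" "R2 = closed_segment B C"
    by (auto simp: opposite_sides_def)
  then show ?thesis
  proof cases
    case 1
    then show ?thesis by (intro that[of A "B - A" "C - B"]) (simp_all add: D algebra_simps)
  next
    case 2
    then show ?thesis by (intro that[of C "A - B" "B - C"]) (simp_all add: D algebra_simps)
  next
    case 3
    then show ?thesis by (intro that[of B "C - B" "A - B"]) (simp_all add: D algebra_simps)
  next
    case 4
    then show ?thesis by (intro that[of D "B - C" "B - A"]) (simp_all add: D algebra_simps)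
  qed
qed

text \<open>Since \<open>p\<close> is a multiple of \<open>d\<close>, \<open>q\<close> is orthogonal
  to \<open>d\<close> and joins the two parallel lines. Hence \<open>e = q + c *\<^sub>R d\<close>,
  \<open>norm q\<close> is the height over \<open>d\<close>, and both sides are the squared
  area.\<close>

lemma parallel_strip:
  fixes d e p q :: "'a :: euclidean_space"
  assumes "closed_segment E (E + p) \<subseteq> affine hull (closed_segment X (X + d))"
    "closed_segment (E + p + q) (E + q) \<subseteq> affine hull (closed_segment (X + d + e) (X + e))"
    and pq: "p \<bullet> q = 0" and p: "p \<noteq> 0"
  shows "(norm q * norm d)^2 = (norm d)^2 * (norm e)^2 - (d \<bullet> e)^2"
proof -
  have "E \<in> affine hull {X, X + d}" "E + p \<in> affine hull {X, X + d}"
    "E + q \<in> affine hull {X + e, X + d + e}"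
    using assms(1,2) by (auto simp: insert_commute)
  then obtain r s u where r: "E = X + r *\<^sub>R d" and s: "E + p = X + s *\<^sub>R d"
    and u: "E + q = X + e + u *\<^sub>R d"
    by (fastforce simp: affine_hull_2_alt add.assoc add.commute[of d e])
  have "p = (s - r) *\<^sub>R d" using r s by (simp add: algebra_simps)
  then have dq: "d \<bullet> q = 0" using pq p by auto
  define c where "c = r - u"
  have e: "e = q + c *\<^sub>R d" using r u by (simp add: c_def algebra_simps)
  have "d \<bullet> e = c * (d \<bullet> d)" "e \<bullet> e = q \<bullet> q + c^2 * (d \<bullet> d)"
    unfolding e using dq by (simp_all add: inner_add inner_commute power2_eq_square)
  then show ?thesis
    by (simp add: power_mult_distrib power2_norm_eq_inner) (simp add: power2_eq_square algebra_simps)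
qed

text \<open>Turns the configuration into numbers: \<open>d\<close> is the side extended by the
  rectangle, \<open>W\<close> and \<open>H\<close> are the rectangle's sides along and across
  \<open>d\<close>, and \<open>\<delta>\<close> is up to sign the inner product of adjacent sides.
  The equations express equability, the length of the shared diagonal, and the area as a Gram
  determinant.\<close>

lemma pythagorean_LEP_sides:
  assumes "pythagorean_LEP A B C D"
  obtains d e :: "real^2" and W H \<delta> :: real where
    "norm d = dist A B \<and> norm e = dist B C \<or> norm d = dist B C \<and> norm e = dist A B"
    "W \<in> \<int>" "H \<in> \<int>" "\<delta> \<in> \<int>" "(norm d)^2 \<in> \<int>" "W \<noteq> 0" "norm d > 0" "norm e > 0"
    "H * norm d = 2 * (norm d + norm e)"
    "W^2 + H^2 = (norm d)^2 + (norm e)^2 + 2 * \<delta>"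
    "(H * norm d)^2 = (norm d)^2 * (norm e)^2 - \<delta>^2"
proof -
  from assms obtain E F G H where par: "parallelogram A B C D"
    and lat: "lattice_point A" "lattice_point B" "lattice_point C"
    and per: "perimeter A B C D = area A B C D"
    and circ: "circumscribes E F G H A B C D" and int: "dist E F \<in> \<int>" "dist F G \<in> \<int>"
    by (auto simp: pythagorean_LEP_def LEP_def)
  from circ have rect: "rectangle E F G H"
    and diag: "diagonals E F G H \<inter> diagonals A B C D \<noteq> {}"
    by (auto simp: circumscribes_def)
  from circ obtain R1 R2 P1 P2 where R: "(R1, R2) \<in> opposite_sides E F G H"
    and P: "(P1, P2) \<in> opposite_sides A B C D"
    and sub: "R1 \<subseteq> affine hull P1" "R2 \<subseteq> affine hull P2"
    unfolding circumscribes_def by blast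
  define v w where "v = B - A" and "w = C - B"
  have BC: "B - A = C - D" and FG: "F - E = G - H"
    using par rect by (auto simp: rectangle_def parallelogram_def)
  obtain X d e where Pd: "P1 = closed_segment X (X + d)" "P2 = closed_segment (X + d + e) (X + e)"
    and de: "(d, e) \<in> {(v, w), (- v, - w), (w, - v), (- w, v)}"
    using opposite_sides_parallelogram[OF BC P] unfolding v_def w_def by (metis minus_diff_eq)
  obtain Y p q where Rp: "R1 = closed_segment Y (Y + p)" "R2 = closed_segment (Y + p + q) (Y + q)"
    and pq: "(p, q) \<in> {(F - E, G - F), (E - F, F - G), (G - F, E - F), (F - G, F - E)}"
    using opposite_sides_parallelogram[OF FG R] by blast
  have orth: "(F - E) \<bullet> (G - F) = 0"
  proof -
    have "H - E = G - F" using FG by (simp add: algebra_simps)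
    then show ?thesis using rect by (simp add: rectangle_def orthogonal_def)
  qed
  have "E \<noteq> F" "F \<noteq> G" using rect by (auto simp: rectangle_def parallelogram_def)
  then have pq0: "p \<noteq> 0" "q \<noteq> 0" and pq_orth: "p \<bullet> q = 0"
    and pq_int: "norm p \<in> \<int>" "norm q \<in> \<int>"
    using pq orth int by (auto simp: dist_norm norm_minus_commute inner_diff inner_commute)
  have pq_norm: "(norm p)^2 + (norm q)^2 = (dist E F)^2 + (dist F G)^2"
    using pq by (auto simp: dist_norm norm_minus_commute)
  have EG: "(dist E G)^2 = (norm p)^2 + (norm q)^2"
    unfolding pq_norm unfolding dist_norm power2_norm_eq_inner using orth
    by (simp add: inner_diff inner_commute algebra_simps)
  have FH: "(dist F H)^2 = (norm p)^2 + (norm q)^2"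
  proof -
    have "F - H = (F - E) - (G - F)" using FG by (simp add: algebra_simps)
    then have "(dist F H)^2 = (norm ((F - E) - (G - F)))^2" by (simp only: dist_norm)
    also have "\<dots> = (norm (F - E))^2 + (norm (G - F))^2"
      using dot_norm_neg[of "F - E" "G - F"] orth by simp
    finally show ?thesis by (simp add: pq_norm dist_norm norm_minus_commute)
  qed
  have AC: "(dist A C)^2 = (norm v)^2 + (norm w)^2 + 2 * (v \<bullet> w)"
    unfolding dist_norm power2_norm_eq_inner v_def w_def
    by (simp add: inner_diff inner_commute algebra_simps)
  have BD: "(dist B D)^2 = (norm v)^2 + (norm w)^2 + 2 * (- (v \<bullet> w))"
  proof -
    have "B - D = v - w" using BC by (simp add: v_def w_def algebra_simps)
    then show ?thesis
      unfolding dist_norm using dot_norm_neg[of v w] by simp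
  qed
  \<comment> \<open>A segment determines its set of endpoints; as both diagonals of the rectangle
    have the same length, it does not matter which one is shared.\<close>
  from diag have "{E, G} = {A, C} \<or> {E, G} = {B, D} \<or> {F, H} = {A, C} \<or> {F, H} = {B, D}"
    unfolding diagonals_def closed_segment_eq[symmetric] by blast
  then have "(norm p)^2 + (norm q)^2 \<in> {(dist A C)^2, (dist B D)^2}"
    using EG FH by (auto simp: doubleton_eq_iff dist_commute)
  \<comment> \<open>The sign of \<open>\<delta>\<close> records which diagonal of the parallelogram
    is shared.\<close>
  then obtain \<delta> where \<delta>: "\<delta> \<in> {v \<bullet> w, - (v \<bullet> w)}"
    and sq: "(norm p)^2 + (norm q)^2 = (norm v)^2 + (norm w)^2 + 2 * \<delta>"
    unfolding AC BD by blast
  have vw_int: "v $ i \<in> \<int>" "w $ i \<in> \<int>" for i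
    using lat by (auto simp: v_def w_def lattice_point_def)
  then have ints: "v \<bullet> w \<in> \<int>" "v \<bullet> v \<in> \<int>" "w \<bullet> w \<in> \<int>"
    by (auto simp: inner_vec_2)
  have vw0: "v \<noteq> 0" "w \<noteq> 0" using par by (auto simp: parallelogram_def v_def w_def)
  have norms: "norm d = norm v \<and> norm e = norm w \<or> norm d = norm w \<and> norm e = norm v"
    and de_inner: "(d \<bullet> e)^2 = (v \<bullet> w)^2"
    using de by (auto simp: inner_commute)
  have "(norm q * norm d)^2 = (norm d)^2 * (norm e)^2 - (d \<bullet> e)^2"
    using parallel_strip[OF _ _ pq_orth pq0(1)] sub unfolding Pd Rp by blast
  also have "\<dots> = (area A B C D)^2"
    using norms de_inner by (auto simp: area_parallelogram_sq[OF par] v_def w_def)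
  finally have "norm q * norm d = area A B C D"
    by (rule power2_eq_imp_eq) (simp_all add: area_def)
  then have area: "norm q * norm d = 2 * (norm d + norm e)"
    using norms perimeter_parallelogram[OF par] per
    by (auto simp: v_def w_def dist_norm norm_minus_commute)
  show ?thesis
  proof (rule that)
    show "norm d = dist A B \<and> norm e = dist B C \<or> norm d = dist B C \<and> norm e = dist A B"
      using norms by (simp add: v_def w_def dist_norm norm_minus_commute)
    show "norm p \<in> \<int>" "norm q \<in> \<int>" "norm p \<noteq> 0" using pq_int pq0 by auto
    show "\<delta> \<in> \<int>" using \<delta> ints by auto
    show "(norm d)^2 \<in> \<int>" using norms ints by (metis power2_norm_eq_inner)
    show "norm d > 0" "norm e > 0" using de vw0 by auto
    show "norm q * norm d = 2 * (norm d + norm e)" by (rule area)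
    show "(norm p)^2 + (norm q)^2 = (norm d)^2 + (norm e)^2 + 2 * \<delta>"
      using sq norms by auto
    show "(norm q * norm d)^2 = (norm d)^2 * (norm e)^2 - \<delta>^2"
      using \<open>(norm q * norm d)^2 = (norm d)^2 * (norm e)^2 - (d \<bullet> e)^2\<close> de_inner \<delta> by auto
  qed
qed

section \<open>From the rectangle to the Pell-type equation\<close>

lemma integer_if_rational_sqrt:
  fixes x W :: real
  assumes "x^2 \<in> \<int>" "W * x \<in> \<int>" "W \<in> \<int>" "W \<noteq> 0"
  shows "x \<in> \<int>"
proof -
  obtain m n w :: int where m: "x^2 = of_int m" and n: "W * x = of_int n" and w: "W = of_int w"
    using assms by (auto elim!: Ints_cases)
  have "(of_int n :: real)^2 = of_int m * (of_int w)^2"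
    unfolding n[symmetric] m[symmetric] w[symmetric] by (simp add: power_mult_distrib)
  then have "n^2 = m * w^2" by (metis of_int_eq_iff of_int_mult of_int_power)
  then have "w^2 dvd n^2" by simp
  then have "w dvd n" by simp
  then obtain c where "n = w * c" by blast
  then have "x = of_int c" using n w assms(4) by simp
  then show ?thesis by simp
qed

text \<open>The last two equations combine to \<open>(W * l)^2 = (l^2 + \<delta>)^2\<close>, so
  \<open>l\<close> is rational with an integer square, hence an integer. Then
  \<open>\<delta>\<close> is an integer multiple of \<open>l\<close>, and dividing the area equation
  by \<open>l^2\<close> gives the Pell-type equation.\<close>

lemma integer_sides:
  fixes l m W H \<delta> :: real
  assumes ints: "W \<in> \<int>" "H \<in> \<int>" "\<delta> \<in> \<int>" "l^2 \<in> \<int>" and pos: "W \<noteq> 0" "l > 0" "m > 0"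
    and H: "H * l = 2 * (l + m)" and W: "W^2 + H^2 = l^2 + m^2 + 2 * \<delta>"
    and \<delta>: "(H * l)^2 = l^2 * m^2 - \<delta>^2"
  obtains a k t :: int where "l = of_int a" "0 < a" "0 < k" "2 * m = of_int (k * a)"
    "t^2 = (a^2 - 4) * k^2 - 16 * k - 16"
proof -
  have "(W * l)^2 = (W^2 + H^2) * l^2 - (H * l)^2" by (simp add: power_mult_distrib algebra_simps)
  also have "\<dots> = (l^2 + \<delta>)^2" unfolding W \<delta> by (simp add: power2_eq_square algebra_simps)
  finally have Wl: "W * l = l^2 + \<delta> \<or> W * l = - (l^2 + \<delta>)" by (simp add: power2_eq_iff)
  moreover have "l^2 + \<delta> \<in> \<int>" using ints by simp
  ultimately have "W * l \<in> \<int>" by (metis Ints_minus)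
  then have "l \<in> \<int>" using integer_if_rational_sqrt ints pos by blast
  then obtain a where a: "l = of_int a" by (elim Ints_cases)
  obtain h where h: "H = of_int h" using ints by (elim Ints_cases)
  define k where "k = h - 2"
  have k: "of_int k * l = 2 * m" using H by (simp add: k_def h algebra_simps)
  have kpos: "0 < k" using k pos by (metis mult_pos_pos of_int_0_less_iff zero_less_mult_pos2 zero_less_numeral)
  from Wl have "\<delta> = (W - l) * l \<or> \<delta> = (- W - l) * l"
    by (auto simp: power2_eq_square algebra_simps)
  moreover have "W - l \<in> \<int>" "- W - l \<in> \<int>" using ints \<open>l \<in> \<int>\<close> by auto
  ultimately obtain s where s: "\<delta> = of_int s * l" by (metis Ints_cases)
  have "l^2 * (4 * (of_int s)^2) = 4 * (l^2 * m^2 - (H * l)^2)"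
    using \<delta> by (simp add: s power_mult_distrib)
  also have "\<dots> = l^2 * ((2 * m)^2 - 4 * H^2)"
    by (simp add: power_mult_distrib algebra_simps)
  also have "\<dots> = l^2 * (((of_int a)^2 - 4) * (of_int k)^2 - 16 * of_int k - 16)"
    unfolding k[symmetric] h a k_def by (simp add: power2_eq_square algebra_simps)
  finally have "4 * (of_int s)^2 = ((of_int a)^2 - 4) * (of_int k)^2 - 16 * of_int k - (16 :: real)"
    using pos by simp
  then have "of_int ((2 * s)^2) = (of_int ((a^2 - 4) * k^2 - 16 * k - 16) :: real)"
    by (simp add: power_mult_distrib)
  then have "(2 * s)^2 = (a^2 - 4) * k^2 - 16 * k - 16" by (simp only: of_int_eq_iff)
  then show ?thesis using a kpos k pos by (intro that[of a k "2 * s"]) auto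
qed

section \<open>Explicit parallelograms\<close>

text \<open>The parallelogram has base \<open>a\<close> on the horizontal axis, height
  \<open>h\<close> and horizontal offset \<open>\<bar>s\<bar>\<close>; the axis-parallel rectangle
  of width \<open>a + \<bar>s\<bar>\<close> and height \<open>h\<close> shares its diagonal from
  \<open>A\<close> to \<open>C\<close>.\<close>

lemma pythagorean_LEP_construct:
  fixes a b h s :: int
  assumes "0 < a" "0 < h" "0 \<le> b" and bs: "b^2 = h^2 + s^2" and area: "a * h = 2 * (a + b)"
  shows "pythagorean_LEP_with_sides a b"
proof -
  \<comment> \<open>The absolute value makes the parallelogram lean to the right, so that the shared
    diagonal is always the one from \<open>A\<close> to \<open>C\<close>.\<close>
  define a' h' s' :: real where defs: "a' = of_int a" "h' = of_int h" "s' = of_int \<bar>s\<bar>"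
  have pos: "0 < a'" "0 < h'" "0 \<le> s'" using assms by (auto simp: defs)
  have ints: "a' \<in> \<int>" "h' \<in> \<int>" "s' \<in> \<int>" by (auto simp: defs)
  define A B C D :: "real^2" where ABCD: "A = 0" "B = vector [a', 0]" "C = vector [a' + s', h']" "D = vector [s', h']"
  define F H :: "real^2" where FH: "F = vector [a' + s', 0]" "H = vector [0, h']"
  note all = ABCD FH
  \<comment> \<open>Stated for a general \<open>c\<close> to serve both \<open>B\<close> and
    \<open>F\<close>.\<close>
  have not_coll: "\<not> collinear {A, vector [c, 0], C}" if "0 < c" for c
  proof
    assume "collinear {A, vector [c, 0], C}"
    then show False
      using that pos unfolding ABCD(1) collinear_lemma by (auto simp: ABCD vec_eq_iff forall_2)
  qed
  have par: "parallelogram A B C D"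
    using not_coll[of a'] pos by (auto simp: parallelogram_def ABCD vec_eq_iff forall_2)
  have rect: "rectangle A F C H"
    using not_coll[of "a' + s'"] pos
    by (auto simp: rectangle_def parallelogram_def orthogonal_def inner_vec_2 all vec_eq_iff forall_2)
  have AB: "dist A B = of_int a" and CH: "dist A F = of_int (a + \<bar>s\<bar>)" and FC: "dist F C = of_int h"
    using pos by (auto simp: all dist_norm norm_vec_def L2_set_def sum_2 defs)
  have BC: "dist B C = of_int b"
  proof -
    have "(of_int b :: real)^2 = s'^2 + h'^2" unfolding defs
      by (metis add.commute bs of_int_add of_int_power power2_abs)
    then have "sqrt (s'^2 + h'^2) = of_int b"
      using assms(3) by (intro real_sqrt_unique) auto
    then show ?thesis by (simp add: all dist_norm norm_vec_def L2_set_def sum_2)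
  qed
  have "area A B C D = a' * h'"
    unfolding area_parallelogram[OF par] using pos by (simp add: ABCD)
  also have "\<dots> = of_int (a * h)" by (simp add: defs)
  also have "\<dots> = perimeter A B C D"
    unfolding area perimeter_parallelogram[OF par] AB BC by simp
  finally have lep: "LEP A B C D"
    using par ints by (auto simp: LEP_def lattice_point_def ABCD forall_2)
  have "B \<in> closed_segment A F" "D \<in> closed_segment H C"
  proof -
    define u where "u = a' / (a' + s')"
    then have "0 \<le> u" "u \<le> 1" and u: "u * (a' + s') = a'" using pos by auto
    then show "B \<in> closed_segment A F"
      unfolding in_segment by (intro conjI exI[of _ u]) (simp_all add: all vec_eq_iff forall_2)
    define z where "z = s' / (a' + s')"
    then have "0 \<le> z" "z \<le> 1" and z: "z * (a' + s') = s'" using pos by auto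
    moreover have "D = (1 - z) *\<^sub>R H + z *\<^sub>R C"
      using z by (simp add: all vec_eq_iff forall_2 left_diff_distrib)
    ultimately show "D \<in> closed_segment H C" unfolding in_segment by blast
  qed
  then have "B \<in> convex hull {A, F, C, H}" "D \<in> convex hull {A, F, C, H}"
    using closed_segment_subset_convex_hull[of A "{A, F, C, H}" F]
      closed_segment_subset_convex_hull[of H "{A, F, C, H}" C]
    by (auto simp: hull_inc)
  then have sub: "convex hull {A, B, C, D} \<subseteq> convex hull {A, F, C, H}"
    by (intro hull_minimal) (auto intro: hull_inc)
  have "closed_segment A F \<subseteq> affine hull (closed_segment A B)"
    "closed_segment C H \<subseteq> affine hull (closed_segment C D)"
  proof -
    have "F = A + ((a' + s') / a') *\<^sub>R (B - A)" "H = C + ((a' + s') / a') *\<^sub>R (D - C)"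
      using pos by (auto simp: all vec_eq_iff forall_2)
    then have "{A, F} \<subseteq> affine hull {A, B}" "{C, H} \<subseteq> affine hull {C, D}"
      by (auto simp: affine_hull_2_alt hull_inc)
    then show "closed_segment A F \<subseteq> affine hull (closed_segment A B)"
      "closed_segment C H \<subseteq> affine hull (closed_segment C D)"
      unfolding segment_convex_hull
      by (simp_all add: hull_minimal affine_affine_hull affine_imp_convex)
  qed
  moreover have "(closed_segment A F, closed_segment C H) \<in> opposite_sides A F C H"
    "(closed_segment A B, closed_segment C D) \<in> opposite_sides A B C D"
    by (simp_all add: opposite_sides_def)
  moreover have "closed_segment A C \<in> diagonals A F C H \<inter> diagonals A B C D"
    by (simp add: diagonals_def)
  ultimately have "circumscribes A F C H A B C D"
    unfolding circumscribes_def using rect par sub by blast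
  then have "pythagorean_LEP A B C D"
    unfolding pythagorean_LEP_def using lep CH FC by (metis Ints_of_int)
  then show ?thesis
    unfolding pythagorean_LEP_with_sides_def using AB BC by metis
qed

section \<open>Side lengths of Pythagorean equable parallelograms\<close>

text \<open>If the rectangle extends the shorter side, then \<open>k = 2 * b / a\<close> is at least
  2. If it extends the longer one, then \<open>k \<le> 2\<close>: either the sides are equal, or
  \<open>k = 1\<close> and the sides are 3, 6 or 5, 10.\<close>

lemma pythagorean_LEP_with_sidesD:
  assumes "pythagorean_LEP_with_sides a b" "a \<le> b"
  obtains l k t :: int where "a = of_int l" "0 < l" "2 \<le> k" "2 * b = of_int (k * l)"
    "t^2 = (l^2 - 4) * k^2 - 16 * k - 16"
proof -
  from assms(1) obtain A B C D where "pythagorean_LEP A B C D"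
    and sides: "{dist A B, dist B C} = {a, b}"
    by (auto simp: pythagorean_LEP_with_sides_def)
  from this(1) obtain d e :: "real^2" and W H \<delta> where
    "norm d = dist A B \<and> norm e = dist B C \<or> norm d = dist B C \<and> norm e = dist A B"
    and rest: "W \<in> \<int>" "H \<in> \<int>" "\<delta> \<in> \<int>" "(norm d)^2 \<in> \<int>" "W \<noteq> 0" "norm d > 0" "norm e > 0"
    "H * norm d = 2 * (norm d + norm e)"
    "W^2 + H^2 = (norm d)^2 + (norm e)^2 + 2 * \<delta>"
    "(H * norm d)^2 = (norm d)^2 * (norm e)^2 - \<delta>^2"
    by (rule pythagorean_LEP_sides)
  then have or: "norm d = a \<and> norm e = b \<or> norm d = b \<and> norm e = a"
    using sides by (auto simp: doubleton_eq_iff)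
  from integer_sides[OF rest] obtain l k t :: int where l: "norm d = of_int l" "0 < l" "0 < k"
    "2 * norm e = of_int (k * l)" and eq: "t^2 = (l^2 - 4) * k^2 - 16 * k - 16"
    by blast
  from or show ?thesis
  proof
    assume *: "norm d = a \<and> norm e = b"
    then have "of_int (2 * l) \<le> (of_int (k * l) :: real)" using l(1,4) assms(2) by linarith
    then have "2 * l \<le> k * l" by (simp only: of_int_le_iff)
    then have "2 \<le> k" using l by simp
    then show ?thesis using that * l eq by blast
  next
    assume *: "norm d = b \<and> norm e = a"
    then have "of_int (k * l) \<le> (of_int (2 * l) :: real)" using l(1,4) assms(2) by linarith
    then have "k * l \<le> 2 * l" by (simp only: of_int_le_iff)
    then have "k \<le> 2" using l by simp
    then consider "k = 2" | "k = 1" using \<open>0 < k\<close> by linarith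
    then show ?thesis
    proof cases
      case 1
      then show ?thesis using that[of l 2 t] * l eq by simp
    next
      case 2
      then have "t^2 = l^2 - 36" using eq by simp
      \<comment> \<open>In both cases the shorter side also satisfies the equation, with
        \<open>k = 4\<close> and \<open>t = 0\<close> or \<open>t = 16\<close>.\<close>
      then have "l = 6 \<or> l = 10" using diff_squares_eq_36 l by blast
      then show ?thesis
      proof
        assume "l = 6"
        then show ?thesis using that[of 3 4 0] * l 2 by simp
      next
        assume "l = 10"
        then show ?thesis using that[of 5 4 16] * l 2 by simp
      qed
    qed
  qed
qed

text \<open>Common frame of the five families: \<open>param\<close> puts every admissible
  \<open>b = k * a / 2\<close> into the formula, while \<open>construct\<close> supplies the height
  \<open>h\<close> and offset \<open>s\<close> of a parallelogram for each solution of
  \<open>P\<close>.\<close>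

lemma long_sides_eq:
  fixes a :: int and F :: "int \<Rightarrow> int \<Rightarrow> real"
  assumes a: "0 < a"
    and param: "\<And>k t. 0 < k \<Longrightarrow> t^2 = (a^2 - 4) * k^2 - 16 * k - 16 \<Longrightarrow>
      \<exists>x y. P x y \<and> real_of_int (k * a) = 2 * F x y"
    and construct: "\<And>x y. P x y \<Longrightarrow> \<exists>b h s. F x y = real_of_int b \<and> 0 < h \<and> b^2 = h^2 + s^2 \<and> a * h = 2 * (a + b)"
  shows "long_sides (of_int a) = {b. of_int a \<le> b \<and> (\<exists>x y. P x y \<and> b = F x y)}"
proof (intro set_eqI iffI)
  fix b
  assume "b \<in> long_sides (of_int a)"
  then have "of_int a \<le> b" and "pythagorean_LEP_with_sides (of_int a) b"
    by (auto simp: long_sides_def)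
  then obtain l k t :: int where "real_of_int a = of_int l" "2 \<le> k" "2 * b = of_int (k * l)"
    "t^2 = (l^2 - 4) * k^2 - 16 * k - 16"
    by (elim pythagorean_LEP_with_sidesD) blast
  then have k: "0 < k" "2 * b = of_int (k * a)" "t^2 = (a^2 - 4) * k^2 - 16 * k - 16"
    by simp_all
  obtain x y where "P x y" "of_int (k * a) = 2 * F x y" using param[OF k(1,3)] by blast
  moreover from this have "b = F x y" using k(2) by linarith
  ultimately show "b \<in> {b. of_int a \<le> b \<and> (\<exists>x y. P x y \<and> b = F x y)}"
    using \<open>of_int a \<le> b\<close> by blast
next
  fix b
  assume "b \<in> {b. of_int a \<le> b \<and> (\<exists>x y. P x y \<and> b = F x y)}"
  then obtain x y where ab: "of_int a \<le> b" and P: "P x y" and b: "b = F x y" by blast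
  obtain c h s where c: "b = real_of_int c" and *: "0 < h" "c^2 = h^2 + s^2" "a * h = 2 * (a + c)"
    using construct[OF P] b by blast
  have "0 \<le> c" using ab a unfolding c by simp
  then show "b \<in> long_sides (of_int a)"
    using pythagorean_LEP_construct[OF a *(1) _ *(2,3)] ab by (simp add: long_sides_def c)
qed

text \<open>Each step raises \<open>x\<close> by at least \<open>\<beta> * y \<ge> 1\<close>, so
  \<open>x\<close>, and with it \<open>F x y\<close>, is unbounded.\<close>

lemma infinite_pell_values:
  fixes F :: "int \<Rightarrow> int \<Rightarrow> real"
  assumes init: "P x0 y0" "0 \<le> x0" "0 < y0"
    and step: "\<And>x y. P x y \<Longrightarrow> P (\<alpha> * x + \<beta> * y) (\<gamma> * x + \<alpha> * y)"
    and pos: "1 \<le> \<alpha>" "1 \<le> \<beta>" "0 \<le> \<gamma>"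
    and F: "\<And>x y. real_of_int (x^2) \<le> 2 * F x y"
  shows "infinite {b. c \<le> b \<and> (\<exists>x y. P x y \<and> b = F x y)}"
proof
  have ex: "\<exists>x y. P x y \<and> int n \<le> x \<and> 0 < y" for n
  proof (induction n)
    case 0
    then show ?case using init by auto
  next
    case (Suc n)
    then obtain x y where xy: "P x y" "int n \<le> x" "0 < y" by blast
    have "x \<le> \<alpha> * x" "y \<le> \<alpha> * y" "y \<le> \<beta> * y" "0 \<le> \<gamma> * x"
      using mult_right_mono[of 1 \<alpha> x] mult_right_mono[of 1 \<alpha> y] mult_right_mono[of 1 \<beta> y] pos xy
      by auto
    then have "int (Suc n) \<le> \<alpha> * x + \<beta> * y" "0 < \<gamma> * x + \<alpha> * y" using xy by linarith+
    then show ?case using step[OF xy(1)] by blast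
  qed
  assume "finite {b. c \<le> b \<and> (\<exists>x y. P x y \<and> b = F x y)}" (is "finite ?S")
  then obtain M where M: "\<And>b. b \<in> ?S \<Longrightarrow> b \<le> M" by (meson bdd_above_def bdd_above_finite)
  obtain n where n: "max (\<bar>c\<bar>) (\<bar>M\<bar>) * 2 + 1 < real n" using reals_Archimedean2 by blast
  obtain x y where xy: "P x y" "int n \<le> x" using ex by blast
  have "real n \<le> real_of_int x" using xy(2) by linarith
  also have "real_of_int x \<le> real_of_int (x^2)"
    by (simp only: of_int_le_iff) (use xy(2) n in \<open>auto simp: power2_eq_square intro!: mult_le_cancel_left1[THEN iffD2]\<close>)
  also note F
  finally have "real n \<le> 2 * F x y" .
  then have "F x y \<in> ?S" using n xy by auto
  then show False using M[of "F x y"] n \<open>real n \<le> 2 * F x y\<close> by auto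
qed

theorem theorem3:
  shows "(\<forall>a b. pythagorean_LEP_with_sides a b \<and> a \<le> b \<longrightarrow> a \<in> {3, 4, 5, 6, 10}) \<and>
    (infinite (long_sides 3) \<and>
     long_sides 3 =
       {b. 3 \<le> b \<and> (\<exists>x y :: int. y^2 - 5 * x^2 = 4 \<and> b = 3 * (real_of_int x ^ 2 + real_of_int y ^ 2) / 2)}) \<and>
    (infinite (long_sides 4) \<and>
     long_sides 4 =
       {b. 4 \<le> b \<and> (\<exists>x y :: int. y^2 - 3 * x^2 = 1 \<and> b = 4 * (real_of_int x ^ 2 + real_of_int y ^ 2))}) \<and>
    (infinite (long_sides 5) \<and>
     long_sides 5 =
       {b. 5 \<le> b \<and> (\<exists>x y :: int. 3 * y^2 - 7 * x^2 = 20 \<and> b = (real_of_int x ^ 2 + real_of_int y ^ 2) / 2)}) \<and>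
    (infinite (long_sides 6) \<and>
     long_sides 6 =
       {b. 6 \<le> b \<and> (\<exists>x y :: int. y^2 - 2 * x^2 = 1 \<and> b = 3 * (real_of_int x ^ 2 + real_of_int y ^ 2))}) \<and>
    (infinite (long_sides 10) \<and>
     long_sides 10 =
       {b. 10 \<le> b \<and> (\<exists>x y :: int. 2 * y^2 - 3 * x^2 = 5 \<and> b = real_of_int x ^ 2 + real_of_int y ^ 2)})"
proof (intro conjI allI impI)
  fix a b
  assume "pythagorean_LEP_with_sides a b \<and> a \<le> b"
  then obtain l k t :: int where l: "a = of_int l" "0 < l" "2 \<le> k"
    and "t^2 = (l^2 - 4) * k^2 - 16 * k - 16"
    by (elim conjE pythagorean_LEP_with_sidesD) blast
  then have "l \<in> {3, 4, 5, 6, 10}" by (intro side_cases[of l k t]) auto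
  then show "a \<in> {3, 4, 5, 6, 10}" using l by auto
next
  show eq: "long_sides 3 =
       {b. 3 \<le> b \<and> (\<exists>x y :: int. y^2 - 5 * x^2 = 4 \<and> b = 3 * (real_of_int x ^ 2 + real_of_int y ^ 2) / 2)}"
  proof (rule long_sides_eq[of 3, simplified of_int_numeral])
    fix k t :: int
    assume "0 < k" "t^2 = (3^2 - 4) * k^2 - 16 * k - 16"
    then obtain x y where xy: "y^2 - 5 * x^2 = 4" "k = 6 * x^2 + 4" using pell_param_3 by blast
    then have "k = x^2 + y^2" by linarith
    then have "real_of_int (k * 3) = 2 * (3 * (real_of_int x ^ 2 + real_of_int y ^ 2) / 2)" by simp
    then show "\<exists>x y. y^2 - 5 * x^2 = 4 \<and>
        real_of_int (k * 3) = 2 * (3 * (real_of_int x ^ 2 + real_of_int y ^ 2) / 2)"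
      using xy by blast
  next
    fix x y :: int
    assume xy: "y^2 - 5 * x^2 = 4"
    have "real_of_int (y^2) = real_of_int (5 * x^2 + 4)" using xy by (simp only: of_int_eq_iff)
    then have "3 * (real_of_int x ^ 2 + real_of_int y ^ 2) / 2 = real_of_int (9 * x^2 + 6)" by simp
    \<comment> \<open>Height and offset are \<open>k + 2\<close> and \<open>t / 2\<close> in the
      parametrisation of \<open>pell_param_3\<close>; the other families take them likewise.\<close>
    moreover have "(9 * x^2 + 6)^2 = (6 * x^2 + 6)^2 + (3 * x * y)^2"
    proof -
      have "y^2 = 5 * x^2 + 4" using xy by simp
      then show ?thesis unfolding power_mult_distrib by (simp add: power2_eq_square algebra_simps)
    qed
    ultimately show "\<exists>b h s. 3 * (real_of_int x ^ 2 + real_of_int y ^ 2) / 2 = real_of_int b \<and>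
        0 < h \<and> b^2 = h^2 + s^2 \<and> 3 * h = 2 * (3 + b)"
    proof (intro exI conjI)
      show "0 < 6 * x^2 + 6" by (simp add: add_nonneg_pos)
      show "3 * (6 * x^2 + 6) = 2 * (3 + (9 * x^2 + 6))" by simp
    qed
  qed simp
  show "infinite (long_sides 3)"
    unfolding eq
    \<comment> \<open>Multiplication by \<open>9 + 4 * sqrt 5\<close>, the cube of
      \<open>(3 + sqrt 5) / 2\<close>, whose coefficients are integers.\<close>
    by (rule infinite_pell_values[where ?x0.0 = 0 and ?y0.0 = 2 and \<alpha> = 9 and \<beta> = 4 and \<gamma> = 20])
      (auto simp: power2_eq_square algebra_simps)
next
  show eq: "long_sides 4 =
       {b. 4 \<le> b \<and> (\<exists>x y :: int. y^2 - 3 * x^2 = 1 \<and> b = 4 * (real_of_int x ^ 2 + real_of_int y ^ 2))}"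
  proof (rule long_sides_eq[of 4, simplified of_int_numeral])
    fix k t :: int
    assume "0 < k" "t^2 = (4^2 - 4) * k^2 - 16 * k - 16"
    then obtain x y where xy: "y^2 - 3 * x^2 = 1" "k = 8 * x^2 + 2" using pell_param_4 by blast
    then have "k = 2 * (x^2 + y^2)" by (simp add: algebra_simps)
    then have "real_of_int (k * 4) = 2 * (4 * (real_of_int x ^ 2 + real_of_int y ^ 2))" by simp
    then show "\<exists>x y. y^2 - 3 * x^2 = 1 \<and>
        real_of_int (k * 4) = 2 * (4 * (real_of_int x ^ 2 + real_of_int y ^ 2))"
      using xy by blast
  next
    fix x y :: int
    assume xy: "y^2 - 3 * x^2 = 1"
    have "real_of_int (y^2) = real_of_int (3 * x^2 + 1)" using xy by (simp only: of_int_eq_iff)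
    then have "4 * (real_of_int x ^ 2 + real_of_int y ^ 2) = real_of_int (16 * x^2 + 4)" by simp
    moreover have "(16 * x^2 + 4)^2 = (8 * x^2 + 4)^2 + (8 * x * y)^2"
    proof -
      have "y^2 = 3 * x^2 + 1" using xy by simp
      then show ?thesis unfolding power_mult_distrib by (simp add: power2_eq_square algebra_simps)
    qed
    ultimately show "\<exists>b h s. 4 * (real_of_int x ^ 2 + real_of_int y ^ 2) = real_of_int b \<and>
        0 < h \<and> b^2 = h^2 + s^2 \<and> 4 * h = 2 * (4 + b)"
    proof (intro exI conjI)
      show "0 < 8 * x^2 + 4" by (simp add: add_nonneg_pos)
      show "4 * (8 * x^2 + 4) = 2 * (4 + (16 * x^2 + 4))" by simp
    qed
  qed simp
  show "infinite (long_sides 4)"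
    unfolding eq
    by (rule infinite_pell_values[where ?x0.0 = 0 and ?y0.0 = 1 and \<alpha> = 2 and \<beta> = 1 and \<gamma> = 3])
      (auto simp: power2_eq_square algebra_simps)
next
  show eq: "long_sides 5 =
       {b. 5 \<le> b \<and> (\<exists>x y :: int. 3 * y^2 - 7 * x^2 = 20 \<and> b = (real_of_int x ^ 2 + real_of_int y ^ 2) / 2)}"
  proof (rule long_sides_eq[of 5, simplified of_int_numeral])
    fix k t :: int
    assume "0 < k" "t^2 = (5^2 - 4) * k^2 - 16 * k - 16"
    then obtain x y where xy: "3 * y^2 - 7 * x^2 = 20" "3 * k = 2 * x^2 + 4"
      using pell_param_5 by blast
    then have "k * 5 = x^2 + y^2" by linarith
    then have "real_of_int (k * 5) = 2 * ((real_of_int x ^ 2 + real_of_int y ^ 2) / 2)" by simp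
    then show "\<exists>x y. 3 * y^2 - 7 * x^2 = 20 \<and>
        real_of_int (k * 5) = 2 * ((real_of_int x ^ 2 + real_of_int y ^ 2) / 2)"
      using xy by blast
  next
    fix x y :: int
    assume xy: "3 * y^2 - 7 * x^2 = 20"
    \<comment> \<open>Half the \<open>k\<close> of \<open>pell_param_5\<close>, written without
      division; it shows \<open>x^2\<close> and \<open>y^2\<close> as integer linear
      expressions.\<close>
    define m where "m = y^2 - 2 * x^2 - 6"
    have x2: "x^2 = 3 * m - 2" using xy by (simp add: m_def)
    then have y2: "y^2 = 7 * m + 2" using xy by linarith
    have "0 < m" using x2 zero_le_power2[of x] by linarith
    have "real_of_int (x^2) = real_of_int (3 * m - 2)" "real_of_int (y^2) = real_of_int (7 * m + 2)"
      using x2 y2 by simp_all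
    then have "(real_of_int x ^ 2 + real_of_int y ^ 2) / 2 = real_of_int (5 * m)" by simp
    moreover have "(5 * m)^2 = (2 * m + 2)^2 + (x * y)^2"
      unfolding power_mult_distrib x2 y2 by (simp add: power2_eq_square algebra_simps)
    ultimately show "\<exists>b h s. (real_of_int x ^ 2 + real_of_int y ^ 2) / 2 = real_of_int b \<and>
        0 < h \<and> b^2 = h^2 + s^2 \<and> 5 * h = 2 * (5 + b)"
    proof (intro exI conjI)
      show "0 < 2 * m + 2" using \<open>0 < m\<close> by simp
      show "5 * (2 * m + 2) = 2 * (5 + (5 * m))" by simp
    qed
  qed simp
  show "infinite (long_sides 5)"
    unfolding eq
    \<comment> \<open>Multiplication of \<open>y * sqrt 3 + x * sqrt 7\<close> by
      \<open>55 + 12 * sqrt 21\<close>, the cube of \<open>(5 + sqrt 21) / 2\<close>.\<close>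
    by (rule infinite_pell_values[where ?x0.0 = 1 and ?y0.0 = 3 and \<alpha> = 55 and \<beta> = 36 and \<gamma> = 84])
      (auto simp: power2_eq_square algebra_simps)
next
  show eq: "long_sides 6 =
       {b. 6 \<le> b \<and> (\<exists>x y :: int. y^2 - 2 * x^2 = 1 \<and> b = 3 * (real_of_int x ^ 2 + real_of_int y ^ 2))}"
  proof (rule long_sides_eq[of 6, simplified of_int_numeral])
    fix k t :: int
    assume "0 < k" "t^2 = (6^2 - 4) * k^2 - 16 * k - 16"
    then obtain x y where xy: "y^2 - 2 * x^2 = 1" "k = 3 * x^2 + 1" using pell_param_6 by blast
    then have "k = x^2 + y^2" by linarith
    then have "real_of_int (k * 6) = 2 * (3 * (real_of_int x ^ 2 + real_of_int y ^ 2))" by simp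
    then show "\<exists>x y. y^2 - 2 * x^2 = 1 \<and>
        real_of_int (k * 6) = 2 * (3 * (real_of_int x ^ 2 + real_of_int y ^ 2))"
      using xy by blast
  next
    fix x y :: int
    assume xy: "y^2 - 2 * x^2 = 1"
    have "real_of_int (y^2) = real_of_int (2 * x^2 + 1)" using xy by (simp only: of_int_eq_iff)
    then have "3 * (real_of_int x ^ 2 + real_of_int y ^ 2) = real_of_int (9 * x^2 + 3)" by simp
    moreover have "(9 * x^2 + 3)^2 = (3 * x^2 + 3)^2 + (6 * x * y)^2"
    proof -
      have "y^2 = 2 * x^2 + 1" using xy by simp
      then show ?thesis unfolding power_mult_distrib by (simp add: power2_eq_square algebra_simps)
    qed
    ultimately show "\<exists>b h s. 3 * (real_of_int x ^ 2 + real_of_int y ^ 2) = real_of_int b \<and>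
        0 < h \<and> b^2 = h^2 + s^2 \<and> 6 * h = 2 * (6 + b)"
    proof (intro exI conjI)
      show "0 < 3 * x^2 + 3" by (simp add: add_nonneg_pos)
      show "6 * (3 * x^2 + 3) = 2 * (6 + (9 * x^2 + 3))" by simp
    qed
  qed simp
  show "infinite (long_sides 6)"
    unfolding eq
    by (rule infinite_pell_values[where ?x0.0 = 0 and ?y0.0 = 1 and \<alpha> = 3 and \<beta> = 2 and \<gamma> = 4])
      (auto simp: power2_eq_square algebra_simps)
next
  show eq: "long_sides 10 =
       {b. 10 \<le> b \<and> (\<exists>x y :: int. 2 * y^2 - 3 * x^2 = 5 \<and> b = real_of_int x ^ 2 + real_of_int y ^ 2)}"
  proof (rule long_sides_eq[of 10, simplified of_int_numeral])
    fix k t :: int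
    assume "0 < k" "t^2 = (10^2 - 4) * k^2 - 16 * k - 16"
    then obtain x y where xy: "2 * y^2 - 3 * x^2 = 5" "2 * k = x^2 + 1"
      using pell_param_10 by blast
    then have "k * 5 = x^2 + y^2" by linarith
    then have "real_of_int (k * 5) = real_of_int (x^2 + y^2)" by simp
    then have "real_of_int (k * 10) = 2 * (real_of_int x ^ 2 + real_of_int y ^ 2)" by simp
    then show "\<exists>x y. 2 * y^2 - 3 * x^2 = 5 \<and>
        real_of_int (k * 10) = 2 * (real_of_int x ^ 2 + real_of_int y ^ 2)"
      using xy by blast
  next
    fix x y :: int
    assume xy: "2 * y^2 - 3 * x^2 = 5"
    \<comment> \<open>The \<open>k\<close> of \<open>pell_param_10\<close>, that is
      \<open>(x^2 + 1) / 2\<close>, written without division.\<close>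
    define k where "k = y^2 - x^2 - 2"
    have x2: "x^2 = 2 * k - 1" using xy by (simp add: k_def)
    then have y2: "y^2 = 3 * k + 1" using xy by linarith
    have "0 < k" using x2 zero_le_power2[of x] by linarith
    have "real_of_int (x^2) = real_of_int (2 * k - 1)" "real_of_int (y^2) = real_of_int (3 * k + 1)"
      using x2 y2 by simp_all
    then have "real_of_int x ^ 2 + real_of_int y ^ 2 = real_of_int (5 * k)" by simp
    moreover have "(5 * k)^2 = (k + 2)^2 + (2 * x * y)^2"
      unfolding power_mult_distrib x2 y2 by (simp add: power2_eq_square algebra_simps)
    ultimately show "\<exists>b h s. real_of_int x ^ 2 + real_of_int y ^ 2 = real_of_int b \<and>
        0 < h \<and> b^2 = h^2 + s^2 \<and> 10 * h = 2 * (10 + b)"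
    proof (intro exI conjI)
      show "0 < k + 2" using \<open>0 < k\<close> by simp
      show "10 * (k + 2) = 2 * (10 + (5 * k))" by simp
    qed
  qed simp
  show "infinite (long_sides 10)"
    unfolding eq
    by (rule infinite_pell_values[where ?x0.0 = 1 and ?y0.0 = 2 and \<alpha> = 5 and \<beta> = 4 and \<gamma> = 6])
      (auto simp: power2_eq_square algebra_simps)
qed

end
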